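(* Let $K$ be a field of characteristic zero, let $n\geq 1$ be an integer, and let $k=(k_1,k_2,\ldots,k_n)\in K^n$ with $k_1k_2\cdots k_n\neq 0$. Then the $n$th hom-associative Weyl algebra $A_n^k$ is simple, that is, its only two-sided ideals are $\{0\}$ and $A_n^k$ itself.
   Context: The $n$th Weyl algebra $A_n$ over $K$ is the associative unital $K$-algebra generated by $x_1,\ldots,x_n,y_1,\ldots,y_n$ subject to the relations $x_ix_j=x_jx_i$ and $y_iy_j=y_jy_i$ for all $i,j$, $x_iy_j=y_jx_i$ for $i\neq j$, and $x_iy_i=y_ix_i+1$ for all $i$. For $k=(k_1,\ldots,k_n)\in K^n$, let $\alpha_k$ be the $K$-algebra automorphism of $A_n$ with $\alpha_k(x_i)=x_i$, $\alpha_k(y_i)=y_i+k_i$ for $1\leq i\leq n$ and $\alpha_k(1_{A_n})=1_{A_n}$. The $n$th hom-associative Weyl algebra $A_n^k$ is the Yau twist of $A_n$ by $\alpha_k$: it is the $K$-vector space $A_n$ with the (in general non-associative, non-unital) bilinear product $a*b:=\alpha_k(ab)$, where $ab$ is the product in $A_n$. A two-sided ideal of $A_n^k$ is a $K$-subspace $I$ such that $a*q\in I$ and $q*a\in I$ for all $a\in A_n$ and $q\in I$. *)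

theory Defs
  imports "HOL-Analysis.Finite_Cartesian_Product" "HOL-Library.Poly_Mapping" "HOL.Hull"
begin

section \<open>Two-sided ideals and simplicity\<close>

text \<open>The product \<open>m\<close> is an explicit argument, and neither associativity nor a unit is assumed.\<close>

definition two_sided_ideal ::
    "('k::comm_ring_1 \<Rightarrow> 'b::ab_group_add \<Rightarrow> 'b) \<Rightarrow> ('b \<Rightarrow> 'b \<Rightarrow> 'b) \<Rightarrow> 'b set \<Rightarrow> bool"
  where "two_sided_ideal s m I \<longleftrightarrow>
    module.subspace s I \<and> (\<forall>a. \<forall>q\<in>I. m a q \<in> I \<and> m q a \<in> I)"

definition simple_algebra ::
    "('k::comm_ring_1 \<Rightarrow> 'b::ab_group_add \<Rightarrow> 'b) \<Rightarrow> ('b \<Rightarrow> 'b \<Rightarrow> 'b) \<Rightarrow> bool"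
  where "simple_algebra s m \<longleftrightarrow> {I. two_sided_ideal s m I} = {{0}, UNIV}"

definition yau_twist :: "('a \<Rightarrow> 'a) \<Rightarrow> 'a \<Rightarrow> 'a \<Rightarrow> 'a::times"
  where "yau_twist \<alpha> a b = \<alpha> (a * b)"


section \<open>The free associative unital algebra\<close>

text \<open>The additive notation on words makes the product of \<^theory>\<open>HOL-Library.Poly_Mapping\<close>
  the product of the monoid algebra, which is the free algebra on \<open>'g\<close>.\<close>

datatype 'g free_monoid = Free_Word (letters: "'g list")

instantiation free_monoid :: (type) monoid_add
begin

definition zero_free_monoid :: "'a free_monoid"
  where "0 = Free_Word []"

definition plus_free_monoid :: "'a free_monoid \<Rightarrow> 'a free_monoid \<Rightarrow> 'a free_monoid"
  where "v + w = Free_Word (letters v @ letters w)"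

instance
  by standard (simp_all add: zero_free_monoid_def plus_free_monoid_def)

end

lemma letters_zero [simp]: "letters 0 = []"
  by (simp add: zero_free_monoid_def)

lemma letters_plus [simp]: "letters (v + w) = letters v @ letters w"
  by (simp add: plus_free_monoid_def)

type_synonym ('g, 'k) free_algebra = "'g free_monoid \<Rightarrow>\<^sub>0 'k"

definition free_gen :: "'g \<Rightarrow> ('g, 'k::field) free_algebra"
  where "free_gen g = Poly_Mapping.single (Free_Word [g]) 1"

definition free_scale :: "'k \<Rightarrow> ('g, 'k) free_algebra \<Rightarrow> ('g, 'k::field) free_algebra"
  where "free_scale c p = Poly_Mapping.single 0 c * p"

interpretation free_algebra: vector_space free_scale
proof
  fix a b :: 'a and x y :: "('b, 'a) free_algebra"
  show "free_scale a (x + y) = free_scale a x + free_scale a y"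
    by (simp add: free_scale_def distrib_left)
  show "free_scale (a + b) x = free_scale a x + free_scale b x"
    by (simp add: free_scale_def distrib_right single_add)
  show "free_scale a (free_scale b x) = free_scale (a * b) x"
    by (simp add: free_scale_def mult_single flip: mult.assoc)
  show "free_scale 1 x = x"
    by (simp add: free_scale_def)
qed

lemma free_algebra_induct [case_names zero single add]:
  fixes p :: "('g, 'k::field) free_algebra"
  assumes "P 0" and "\<And>w c. P (Poly_Mapping.single w c)"
    and add: "\<And>p q. P p \<Longrightarrow> P q \<Longrightarrow> P (p + q)"
  shows "P p"
proof -
  have "P (\<Sum>w\<in>A. Poly_Mapping.single w (Poly_Mapping.lookup p w))" if "finite A" for A
    using that by induction (auto intro: assms)
  moreover have "(\<Sum>w\<in>Poly_Mapping.keys p. Poly_Mapping.single w (Poly_Mapping.lookup p w)) = p"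
    by (rule poly_mapping_eqI)
      (simp add: lookup_sum lookup_single when_def in_keys_iff)
  ultimately show ?thesis
    by (metis finite_keys)
qed

lemma free_scale_central:
  "p * Poly_Mapping.single 0 c = free_scale c (p :: ('g, 'k::field) free_algebra)"
  unfolding free_scale_def
  by (induction p rule: free_algebra_induct)
    (simp_all add: mult_single distrib_left distrib_right mult.commute)

lemma free_scale_mult_left: "free_scale c p * q = free_scale c (p * q)"
  by (simp add: free_scale_def mult.assoc)

lemma free_scale_mult_right: "p * free_scale c q = free_scale c (p * q)"
  by (metis free_scale_central mult.assoc)

text \<open>The algebra endomorphism of the free algebra that sends each generator \<open>g\<close> to \<open>\<phi> g\<close>.\<close>

definition free_subst ::
    "('g \<Rightarrow> ('g, 'k) free_algebra) \<Rightarrow> ('g, 'k) free_algebra \<Rightarrow> ('g, 'k::field) free_algebra"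
  where "free_subst \<phi> p =
    (\<Sum>w\<in>Poly_Mapping.keys p.
      free_scale (Poly_Mapping.lookup p w) (prod_list (map \<phi> (letters w))))"

lemma free_subst_superset:
  assumes "finite A" "Poly_Mapping.keys p \<subseteq> A"
  shows "free_subst \<phi> p = (\<Sum>w\<in>A.
      free_scale (Poly_Mapping.lookup p w) (prod_list (map \<phi> (letters w))))"
  unfolding free_subst_def using assms
  by (intro sum.mono_neutral_left) (auto simp: in_keys_iff)

lemma free_subst_zero [simp]: "free_subst \<phi> 0 = 0"
  by (simp add: free_subst_def)

lemma free_subst_single [simp]:
  "free_subst \<phi> (Poly_Mapping.single w c) = free_scale c (prod_list (map \<phi> (letters w)))"
  by (simp add: free_subst_def)

lemma free_subst_add: "free_subst \<phi> (p + q) = free_subst \<phi> p + free_subst \<phi> q"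
proof -
  let ?A = "Poly_Mapping.keys p \<union> Poly_Mapping.keys q"
  have "Poly_Mapping.keys (p + q) \<subseteq> ?A"
    by (rule keys_add)
  then show ?thesis
    by (simp add: free_subst_superset[of ?A] lookup_add free_algebra.scale_left_distrib sum.distrib)
qed

lemma free_subst_uminus: "free_subst \<phi> (- p) = - free_subst \<phi> p"
  by (metis add.right_inverse free_subst_add free_subst_zero minus_unique)

lemma free_subst_diff: "free_subst \<phi> (p - q) = free_subst \<phi> p - free_subst \<phi> q"
  using free_subst_add[of \<phi> p "- q"] by (simp add: free_subst_uminus)

lemma free_subst_mult: "free_subst \<phi> (p * q) = free_subst \<phi> p * free_subst \<phi> q"
proof (induction p rule: free_algebra_induct)
  case (single v c)
  show ?case
    by (induction q rule: free_algebra_induct)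
      (simp_all add: mult_single free_subst_add distrib_left free_scale_mult_left
        free_scale_mult_right mult.commute)
qed (simp_all add: free_subst_add distrib_right)

lemma free_subst_scale: "free_subst \<phi> (free_scale c p) = free_scale c (free_subst \<phi> p)"
  by (simp add: free_scale_def free_subst_mult)

lemma free_subst_one [simp]: "free_subst \<phi> 1 = 1"
  using free_subst_single[of \<phi> 0 1] by simp

lemma free_subst_gen [simp]: "free_subst \<phi> (free_gen g) = \<phi> g"
  by (simp add: free_gen_def)


section \<open>The Weyl algebra\<close>

text \<open>The quotient of the free algebra on the generators \<open>x\<^sub>i, y\<^sub>i\<close> by the two-sided ideal
  generated by the differences of the two sides of the defining relations. The index
  type \<open>'n\<close> plays the role of \<open>{1..n}\<close>.\<close>

datatype 'n weyl_gen = Gen_x 'n | Gen_y 'n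

inductive_set weyl_relators :: "('n weyl_gen, 'k::field) free_algebra set"
  where
    "free_gen (Gen_x i) * free_gen (Gen_x j) - free_gen (Gen_x j) * free_gen (Gen_x i)
      \<in> weyl_relators"
  | "free_gen (Gen_y i) * free_gen (Gen_y j) - free_gen (Gen_y j) * free_gen (Gen_y i)
      \<in> weyl_relators"
  | "i \<noteq> j \<Longrightarrow>
      free_gen (Gen_x i) * free_gen (Gen_y j) - free_gen (Gen_y j) * free_gen (Gen_x i)
      \<in> weyl_relators"
  | "free_gen (Gen_x i) * free_gen (Gen_y i) - (free_gen (Gen_y i) * free_gen (Gen_x i) + 1)
      \<in> weyl_relators"

definition weyl_ideal :: "('n weyl_gen, 'k::field) free_algebra set"
  where "weyl_ideal = two_sided_ideal free_scale (*) hull weyl_relators"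

lemma weyl_ideal: "two_sided_ideal free_scale (*) weyl_ideal"
  unfolding weyl_ideal_def
  by (rule hull_in) (auto simp: two_sided_ideal_def intro!: free_algebra.subspace_Inter)

lemma weyl_relators_subset: "weyl_relators \<subseteq> weyl_ideal"
  unfolding weyl_ideal_def by (rule hull_subset)

lemma
  shows weyl_ideal_zero [simp]: "0 \<in> weyl_ideal"
    and weyl_ideal_add: "p \<in> weyl_ideal \<Longrightarrow> q \<in> weyl_ideal \<Longrightarrow> p + q \<in> weyl_ideal"
    and weyl_ideal_uminus: "p \<in> weyl_ideal \<Longrightarrow> - p \<in> weyl_ideal"
    and weyl_ideal_diff: "p \<in> weyl_ideal \<Longrightarrow> q \<in> weyl_ideal \<Longrightarrow> p - q \<in> weyl_ideal"
    and weyl_ideal_scale: "p \<in> weyl_ideal \<Longrightarrow> free_scale c p \<in> weyl_ideal"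
    and weyl_ideal_mult_left: "p \<in> weyl_ideal \<Longrightarrow> r * p \<in> weyl_ideal"
    and weyl_ideal_mult_right: "p \<in> weyl_ideal \<Longrightarrow> p * r \<in> weyl_ideal"
  using weyl_ideal unfolding two_sided_ideal_def
  by (auto intro: free_algebra.subspace_0 free_algebra.subspace_add free_algebra.subspace_neg
      free_algebra.subspace_diff free_algebra.subspace_scale)

text \<open>The ideal is proper: the free algebra acts on formal power series in the \<open>y\<close>'s,
  encoded by their coefficient functions, with \<open>x\<^sub>i\<close> as partial derivative and \<open>y\<^sub>i\<close> as multiplication.\<close>

definition gen_action :: "'n weyl_gen \<Rightarrow> (('n \<Rightarrow> nat) \<Rightarrow> 'k::field) \<Rightarrow> ('n \<Rightarrow> nat) \<Rightarrow> 'k"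
  where "gen_action g f m = (case g of
      Gen_x i \<Rightarrow> of_nat (Suc (m i)) * f (m(i := Suc (m i)))
    | Gen_y i \<Rightarrow> (if m i = 0 then 0 else f (m(i := m i - 1))))"

definition free_action ::
    "('n weyl_gen, 'k) free_algebra \<Rightarrow> (('n \<Rightarrow> nat) \<Rightarrow> 'k::field) \<Rightarrow> ('n \<Rightarrow> nat) \<Rightarrow> 'k"
  where "free_action p f m =
    (\<Sum>w\<in>Poly_Mapping.keys p. Poly_Mapping.lookup p w * foldr gen_action (letters w) f m)"

lemma foldr_gen_action_add:
  "foldr gen_action ls (\<lambda>m. f m + g m) = (\<lambda>m. foldr gen_action ls f m + foldr gen_action ls g m)"
  by (induction ls) (auto simp: gen_action_def distrib_left split: weyl_gen.split)

lemma foldr_gen_action_scale: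
  "foldr gen_action ls (\<lambda>m. c * f m) = (\<lambda>m. c * foldr gen_action ls f m)"
  by (induction ls) (auto simp: gen_action_def fun_eq_iff split: weyl_gen.split)

lemma foldr_gen_action_zero: "foldr gen_action ls (\<lambda>m. 0) = (\<lambda>m. 0)"
  using foldr_gen_action_scale[of ls 0] by simp

lemma free_action_superset:
  assumes "finite A" "Poly_Mapping.keys p \<subseteq> A"
  shows "free_action p f m = (\<Sum>w\<in>A. Poly_Mapping.lookup p w * foldr gen_action (letters w) f m)"
  unfolding free_action_def using assms
  by (intro sum.mono_neutral_left) (auto simp: in_keys_iff)

lemma free_action_zero [simp]: "free_action 0 f = (\<lambda>m. 0)"
  by (simp add: free_action_def fun_eq_iff)

lemma free_action_single [simp]:
  "free_action (Poly_Mapping.single w c) f = (\<lambda>m. c * foldr gen_action (letters w) f m)"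
  by (simp add: free_action_def fun_eq_iff)

lemma free_action_add:
  "free_action (p + q) f = (\<lambda>m. free_action p f m + free_action q f m)"
proof -
  let ?A = "Poly_Mapping.keys p \<union> Poly_Mapping.keys q"
  have "Poly_Mapping.keys (p + q) \<subseteq> ?A"
    by (rule keys_add)
  then show ?thesis
    by (simp add: free_action_superset[of ?A] lookup_add distrib_right sum.distrib fun_eq_iff)
qed

lemma free_action_diff:
  "free_action (p - q) f = (\<lambda>m. free_action p f m - free_action q f m)"
  using free_action_add[of "p - q" q f] by (simp add: fun_eq_iff)

lemma free_action_mult: "free_action (p * q) f = free_action p (free_action q f)"
proof (induction p rule: free_algebra_induct)
  case (single v c)
  show ?case
    by (induction q rule: free_algebra_induct)
      (simp_all add: mult_single free_action_add distrib_left foldr_gen_action_add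
        foldr_gen_action_scale foldr_gen_action_zero mult.assoc)
qed (simp_all add: free_action_add distrib_right)

lemma free_action_one [simp]: "free_action 1 f = f"
  by (metis (no_types, lifting) ext foldr_Nil free_action_single id_apply letters_zero mult_1 single_one)

lemma free_action_gen [simp]: "free_action (free_gen g) f = gen_action g f"
  by (simp add: free_gen_def)

lemma free_action_relator:
  assumes "r \<in> weyl_relators"
  shows "free_action r f m = 0"
  using assms
  by induction (auto simp: free_action_diff free_action_add free_action_mult
      gen_action_def fun_upd_twist algebra_simps)

lemma free_action_weyl_ideal:
  assumes "p \<in> weyl_ideal"
  shows "\<forall>f. free_action p f = (\<lambda>m. 0)"
  using assms unfolding weyl_ideal_def
proof (rule hull_induct)
  show "\<forall>f. free_action r f = (\<lambda>m. 0)" if "r \<in> weyl_relators"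
    for r :: "('a weyl_gen, 'b) free_algebra"
    using free_action_relator[OF that] by (simp add: fun_eq_iff)
  have zero: "free_action a (\<lambda>m. 0) = (\<lambda>m. 0)" for a :: "('a weyl_gen, 'b) free_algebra"
    by (simp add: free_action_def foldr_gen_action_zero fun_eq_iff)
  show "two_sided_ideal free_scale (*)
      {p :: ('a weyl_gen, 'b) free_algebra. \<forall>f. free_action p f = (\<lambda>m. 0)}"
    unfolding two_sided_ideal_def free_algebra.subspace_def
    by (simp add: free_action_add free_action_mult zero free_scale_def)
qed

lemma one_notin_weyl_ideal: "1 \<notin> weyl_ideal"
proof
  assume "(1 :: ('n weyl_gen, 'k::field) free_algebra) \<in> weyl_ideal"
  from free_action_weyl_ideal[OF this] have "(\<lambda>m. 1) = (\<lambda>m :: 'n \<Rightarrow> nat. 0 :: 'k)"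
    by simp
  then show False
    by (simp add: fun_eq_iff)
qed

definition weyl_rel ::
    "('n weyl_gen, 'k) free_algebra \<Rightarrow> ('n weyl_gen, 'k::field) free_algebra \<Rightarrow> bool"
  where "weyl_rel p q \<longleftrightarrow> p - q \<in> weyl_ideal"

lemma equivp_weyl_rel:
  "equivp (weyl_rel :: ('n weyl_gen, 'k::field) free_algebra \<Rightarrow> _)" (is "equivp ?R")
proof (rule equivpI)
  show "reflp ?R"
    by (simp add: reflp_def weyl_rel_def)
  show "symp ?R"
    unfolding symp_def weyl_rel_def by (metis minus_diff_eq weyl_ideal_uminus)
  show "transp ?R"
  proof (rule transpI)
    fix p q r :: "('n weyl_gen, 'k) free_algebra"
    assume "weyl_rel p q" "weyl_rel q r"
    then have "(p - q) + (q - r) \<in> weyl_ideal"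
      unfolding weyl_rel_def by (rule weyl_ideal_add)
    then show "weyl_rel p r"
      by (simp add: weyl_rel_def)
  qed
qed

quotient_type (overloaded) ('n, 'k) weyl =
  "('n weyl_gen, 'k::field) free_algebra" / weyl_rel
  by (rule equivp_weyl_rel)

instantiation weyl :: (type, field) ring
begin

lift_definition zero_weyl :: "('a, 'b::field) weyl" is 0 .

lift_definition plus_weyl :: "('a, 'b::field) weyl \<Rightarrow> ('a, 'b) weyl \<Rightarrow> ('a, 'b) weyl" is "(+)"
  unfolding weyl_rel_def by (metis add_diff_add weyl_ideal_add)

lift_definition uminus_weyl :: "('a, 'b::field) weyl \<Rightarrow> ('a, 'b) weyl" is uminus
proof -
  fix p q :: "('a weyl_gen, 'b) free_algebra"
  assume "weyl_rel p q"
  then have "- (p - q) \<in> weyl_ideal"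
    unfolding weyl_rel_def by (rule weyl_ideal_uminus)
  then show "weyl_rel (- p) (- q)"
    by (simp add: weyl_rel_def)
qed

lift_definition minus_weyl :: "('a, 'b::field) weyl \<Rightarrow> ('a, 'b) weyl \<Rightarrow> ('a, 'b) weyl" is "(-)"
proof -
  fix p p' q q' :: "('a weyl_gen, 'b) free_algebra"
  assume "weyl_rel p p'" "weyl_rel q q'"
  then have "(p - p') - (q - q') \<in> weyl_ideal"
    unfolding weyl_rel_def by (rule weyl_ideal_diff)
  then show "weyl_rel (p - q) (p' - q')"
    by (simp add: weyl_rel_def algebra_simps)
qed

lift_definition times_weyl :: "('a, 'b::field) weyl \<Rightarrow> ('a, 'b) weyl \<Rightarrow> ('a, 'b) weyl" is "(*)"
proof -
  fix p p' q q' :: "('a weyl_gen, 'b) free_algebra"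
  assume "weyl_rel p p'" "weyl_rel q q'"
  then have "(p - p') * q + p' * (q - q') \<in> weyl_ideal"
    unfolding weyl_rel_def
    by (intro weyl_ideal_add weyl_ideal_mult_left weyl_ideal_mult_right)
  then show "weyl_rel (p * q) (p' * q')"
    by (simp add: weyl_rel_def algebra_simps)
qed

instance
  by (standard; transfer) (simp_all add: weyl_rel_def algebra_simps)

end

instantiation weyl :: (type, field) ring_1
begin

lift_definition one_weyl :: "('a, 'b::field) weyl" is 1 .

instance
proof
  fix a :: "('a, 'b) weyl"
  show "1 * a = a" "a * 1 = a"
    by (transfer; simp add: weyl_rel_def)+
  show "(0 :: ('a, 'b) weyl) \<noteq> 1"
    by transfer (metis diff_0 minus_minus one_notin_weyl_ideal weyl_ideal_uminus weyl_rel_def)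
qed

end

lift_definition weyl_scale :: "'k::field \<Rightarrow> ('n, 'k) weyl \<Rightarrow> ('n, 'k) weyl" is free_scale
  unfolding weyl_rel_def by (metis free_algebra.scale_right_diff_distrib weyl_ideal_scale)

interpretation weyl: vector_space weyl_scale
  by (standard; transfer)
    (simp_all add: weyl_rel_def free_algebra.scale_right_distrib free_algebra.scale_left_distrib)

lemma weyl_scale_mult_left: "weyl_scale c a * b = weyl_scale c (a * b)"
  by transfer (simp add: weyl_rel_def free_scale_mult_left)

lemma weyl_scale_mult_right: "a * weyl_scale c b = weyl_scale c (a * b)"
  by transfer (simp add: weyl_rel_def free_scale_mult_right)

lift_definition weyl_x :: "'n \<Rightarrow> ('n, 'k::field) weyl" is "\<lambda>i. free_gen (Gen_x i)" .

lift_definition weyl_y :: "'n \<Rightarrow> ('n, 'k::field) weyl" is "\<lambda>i. free_gen (Gen_y i)" .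

lemma weyl_relations:
  fixes i j :: 'n
  shows "weyl_x i * weyl_x j = (weyl_x j * weyl_x i :: ('n, 'k::field) weyl)"
    and "weyl_y i * weyl_y j = (weyl_y j * weyl_y i :: ('n, 'k) weyl)"
    and "i \<noteq> j \<Longrightarrow> weyl_x i * weyl_y j = (weyl_y j * weyl_x i :: ('n, 'k) weyl)"
    and "weyl_x i * weyl_y i = (weyl_y i * weyl_x i + 1 :: ('n, 'k) weyl)"
  by (transfer, use weyl_relators_subset in \<open>force simp: weyl_rel_def intro: weyl_relators.intros\<close>)+


section \<open>The hom-associative Weyl algebra\<close>

definition shift_gen ::
    "'k::field ^ 'n::finite \<Rightarrow> 'n weyl_gen \<Rightarrow> ('n weyl_gen, 'k) free_algebra"
  where "shift_gen k g = (case g of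
      Gen_x i \<Rightarrow> free_gen (Gen_x i)
    | Gen_y i \<Rightarrow> free_gen (Gen_y i) + free_scale (k $ i) 1)"

lemma free_subst_shift_gen_relators:
  assumes "r \<in> weyl_relators"
  shows "free_subst (shift_gen k) r \<in> weyl_relators"
proof -
  have *: "free_subst (shift_gen k) r = r"
    using assms
    by induction (simp_all add: free_subst_diff free_subst_add free_subst_mult shift_gen_def
        algebra_simps free_scale_mult_left free_scale_mult_right)
  show ?thesis
    using assms by (simp add: *)
qed

lemma free_subst_shift_gen_ideal:
  assumes "p \<in> weyl_ideal"
  shows "free_subst (shift_gen k) p \<in> weyl_ideal"
proof (rule hull_induct[OF assms[unfolded weyl_ideal_def]])
  show "free_subst (shift_gen k) r \<in> weyl_ideal" if "r \<in> weyl_relators" for r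
    using free_subst_shift_gen_relators[OF that] weyl_relators_subset by blast
  show "two_sided_ideal free_scale (*) {p. free_subst (shift_gen k) p \<in> weyl_ideal}"
    unfolding two_sided_ideal_def free_algebra.subspace_def
    by (simp add: free_subst_add free_subst_mult free_subst_scale weyl_ideal_add
        weyl_ideal_scale weyl_ideal_mult_left weyl_ideal_mult_right)
qed

text \<open>The map \<open>\<alpha>\<^sub>k\<close>; the lemmas below identify it as the unique
  unital algebra endomorphism with the prescribed values on the generators, and as a bijection.\<close>

lift_definition weyl_shift ::
    "'k::field ^ 'n::finite \<Rightarrow> ('n, 'k) weyl \<Rightarrow> ('n, 'k) weyl"
  is "\<lambda>k. free_subst (shift_gen k)"
  unfolding weyl_rel_def by (metis free_subst_diff free_subst_shift_gen_ideal)

lemma weyl_shift_add: "weyl_shift k (a + b) = weyl_shift k a + weyl_shift k b"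
  by transfer (simp add: weyl_rel_def free_subst_add)

lemma weyl_shift_diff: "weyl_shift k (a - b) = weyl_shift k a - weyl_shift k b"
  by transfer (simp add: weyl_rel_def free_subst_diff)

lemma weyl_shift_scale: "weyl_shift k (weyl_scale c a) = weyl_scale c (weyl_shift k a)"
  by transfer (simp add: weyl_rel_def free_subst_scale)

lemma weyl_shift_mult: "weyl_shift k (a * b) = weyl_shift k a * weyl_shift k b"
  by transfer (simp add: weyl_rel_def free_subst_mult)

lemma weyl_shift_one [simp]: "weyl_shift k 1 = 1"
  by transfer (simp add: weyl_rel_def)

lemma weyl_shift_x [simp]: "weyl_shift k (weyl_x i) = weyl_x i"
  by transfer (simp add: weyl_rel_def shift_gen_def)

lemma weyl_shift_y [simp]: "weyl_shift k (weyl_y i) = weyl_y i + weyl_scale (k $ i) 1"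
  by transfer (simp add: weyl_rel_def shift_gen_def)

lemma weyl_hom_unique:
  fixes f g :: "('n, 'k::field) weyl \<Rightarrow> ('n, 'k) weyl"
  assumes f: "\<And>a b. f (a + b) = f a + f b" "\<And>c a. f (weyl_scale c a) = weyl_scale c (f a)"
      "\<And>a b. f (a * b) = f a * f b" "f 1 = 1"
    and g: "\<And>a b. g (a + b) = g a + g b" "\<And>c a. g (weyl_scale c a) = weyl_scale c (g a)"
      "\<And>a b. g (a * b) = g a * g b" "g 1 = 1"
    and xy: "\<And>i. f (weyl_x i) = g (weyl_x i)" "\<And>i. f (weyl_y i) = g (weyl_y i)"
  shows "f = g"
proof
  fix a :: "('n, 'k) weyl"
  obtain p where a: "a = abs_weyl p"
    by (metis Quotient_weyl Quotient_abs_rep)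
  have gen: "f (abs_weyl (free_gen h)) = g (abs_weyl (free_gen h))" for h
    using xy by (cases h) (simp_all add: weyl_x.abs_eq weyl_y.abs_eq)
  have word: "f (abs_weyl (Poly_Mapping.single (Free_Word ls) 1)) =
      g (abs_weyl (Poly_Mapping.single (Free_Word ls) 1))" for ls
  proof (induction ls)
    case Nil
    then show ?case
      using f(4) g(4) by (simp add: one_weyl.abs_eq flip: zero_free_monoid_def)
  next
    case (Cons h ls)
    have "Poly_Mapping.single (Free_Word (h # ls)) (1::'k) =
        free_gen h * Poly_Mapping.single (Free_Word ls) 1"
      by (simp add: free_gen_def mult_single plus_free_monoid_def)
    then show ?case
      using Cons gen f(3) g(3) by (simp flip: times_weyl.abs_eq)
  qed
  have "f (abs_weyl p) = g (abs_weyl p)"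
  proof (induction p rule: free_algebra_induct)
    case zero
    then show ?case
      using f(1)[of 0 0] g(1)[of 0 0] by (simp flip: zero_weyl.abs_eq)
  next
    case (single w c)
    have "Poly_Mapping.single w c = free_scale c (Poly_Mapping.single (Free_Word (letters w)) 1)"
      by (simp add: free_scale_def mult_single)
    then show ?case
      using word[of "letters w"] f(2) g(2) by (simp flip: weyl_scale.abs_eq)
  next
    case (add p q)
    then show ?case
      using f(1) g(1) by (simp flip: plus_weyl.abs_eq)
  qed
  then show "f a = g a"
    by (simp add: a)
qed

lemma weyl_shift_inverse: "weyl_shift k (weyl_shift (- k) a) = a"
proof -
  have "weyl_shift k \<circ> weyl_shift (- k) = id"
    by (rule weyl_hom_unique)
      (simp_all add: weyl_shift_add weyl_shift_diff weyl_shift_scale weyl_shift_mult)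
  then show ?thesis
    by (metis comp_apply id_apply)
qed

lemma bij_weyl_shift: "bij (weyl_shift k)"
  by (rule bijI') (metis minus_minus weyl_shift_inverse)+

definition hom_weyl_mult ::
    "'k::field ^ 'n::finite \<Rightarrow> ('n, 'k) weyl \<Rightarrow> ('n, 'k) weyl \<Rightarrow> ('n, 'k) weyl"
  where "hom_weyl_mult k = yau_twist (weyl_shift k)"

end

theory Submission
  imports Defs
begin

text \<open>
  The automorphism \<open>\<alpha>\<^sub>k\<close> is locally unipotent, so a subspace stable under it is stable under its
  inverse; hence every ideal of the twisted algebra is an ideal of the Weyl algebra itself. For the
  simplicity of the latter, the partial derivatives with respect to the generators are commuting,
  locally nilpotent inner derivations. Differentiating a nonzero element of an ideal as long as
  possible yields a nonzero element of the ideal that all of them annihilate. Such an element is a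
  scalar: splitting it as \<open>v + z b\<close> with \<open>v\<close> free of the generator \<open>z\<close> forces \<open>b = 0\<close> in
  characteristic zero, so the generators can be removed one at a time.
\<close>

section \<open>Subalgebras generated by some of the generators\<close>

definition weyl_z :: "'n weyl_gen \<Rightarrow> ('n, 'k::field) weyl"
  where "weyl_z g = (case g of Gen_x i \<Rightarrow> weyl_x i | Gen_y i \<Rightarrow> weyl_y i)"

text \<open>Right multiplication by single generators suffices to reach all words over
  \<open>T\<close>, and keeps the induction rule down to one letter at a time.\<close>

inductive_set weyl_subalgebra :: "'n weyl_gen set \<Rightarrow> ('n, 'k::field) weyl set"
  for T :: "'n weyl_gen set"
  where
    one: "1 \<in> weyl_subalgebra T"
  | scale: "a \<in> weyl_subalgebra T \<Longrightarrow> weyl_scale c a \<in> weyl_subalgebra T"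
  | add: "a \<in> weyl_subalgebra T \<Longrightarrow> b \<in> weyl_subalgebra T \<Longrightarrow> a + b \<in> weyl_subalgebra T"
  | mult_gen: "a \<in> weyl_subalgebra T \<Longrightarrow> g \<in> T \<Longrightarrow> a * weyl_z g \<in> weyl_subalgebra T"

lemma weyl_subalgebra_zero: "0 \<in> weyl_subalgebra T"
  using weyl_subalgebra.scale[OF weyl_subalgebra.one, of 0] by simp

lemma weyl_subalgebra_uminus: "a \<in> weyl_subalgebra T \<Longrightarrow> - a \<in> weyl_subalgebra T"
  using weyl_subalgebra.scale[of a T "-1"] by simp

lemma weyl_z_abs: "weyl_z g = abs_weyl (free_gen g)"
  by (simp add: weyl_z_def weyl_x.abs_eq weyl_y.abs_eq split: weyl_gen.split)

text \<open>Makes the induction rule of \<open>weyl_subalgebra\<close> available for every element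
  of the Weyl algebra.\<close>

lemma weyl_subalgebra_UNIV: "a \<in> weyl_subalgebra UNIV"
  for a :: "('n, 'k::field) weyl"
proof -
  obtain p where a: "a = abs_weyl p"
    by (metis Quotient_weyl Quotient_abs_rep)
  have word: "abs_weyl (Poly_Mapping.single (Free_Word ls) (1::'k)) \<in> weyl_subalgebra UNIV"
    for ls :: "'n weyl_gen list"
  proof (induction ls rule: rev_induct)
    case Nil
    then show ?case
      using weyl_subalgebra.one by (simp add: one_weyl.abs_eq flip: zero_free_monoid_def)
  next
    case (snoc g ls)
    have "Poly_Mapping.single (Free_Word (ls @ [g])) (1::'k) =
        Poly_Mapping.single (Free_Word ls) 1 * free_gen g"
      by (simp add: free_gen_def mult_single plus_free_monoid_def)
    then show ?case
      using weyl_subalgebra.mult_gen[OF snoc, of g]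
      by (simp add: weyl_z_abs flip: times_weyl.abs_eq)
  qed
  have "abs_weyl p \<in> weyl_subalgebra UNIV"
  proof (induction p rule: free_algebra_induct)
    case zero
    then show ?case
      using weyl_subalgebra_zero by (simp flip: zero_weyl.abs_eq)
  next
    case (single w c)
    have "Poly_Mapping.single w c = free_scale c (Poly_Mapping.single (Free_Word (letters w)) 1)"
      by (simp add: free_scale_def mult_single)
    then show ?case
      using weyl_subalgebra.scale[OF word[of "letters w"], of c] by (simp flip: weyl_scale.abs_eq)
  next
    case (add p q)
    then show ?case
      using weyl_subalgebra.add by (simp flip: plus_weyl.abs_eq)
  qed
  then show ?thesis
    by (simp add: a)
qed

section \<open>Locally nilpotent operators\<close>

lemma funpow_additive:
  fixes D :: "'a::ab_group_add \<Rightarrow> 'a"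
  assumes "\<And>a b. D (a + b) = D a + D b"
  shows "(D ^^ m) (a + b) = (D ^^ m) a + (D ^^ m) b"
  by (induction m) (simp_all add: assms)

lemma funpow_fixpoint: "f x = x \<Longrightarrow> (f ^^ m) x = x"
  by (induction m) simp_all

lemma funpow_eq_zero_mono:
  fixes D :: "'a::zero \<Rightarrow> 'a"
  assumes "D 0 = 0" "(D ^^ m) a = 0" "m \<le> n"
  shows "(D ^^ n) a = 0"
  by (metis assms comp_apply funpow_add funpow_fixpoint le_add_diff_inverse2)

text \<open>The hypothesis on \<open>a * z\<^sub>g\<close> covers derivations with scalar values on the generators
  as well as \<open>\<alpha>\<^sub>k - id\<close>.\<close>

lemma locally_nilpotent:
  fixes D :: "('n, 'k::field) weyl \<Rightarrow> ('n, 'k) weyl"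
  assumes add: "\<And>a b. D (a + b) = D a + D b"
    and scale: "\<And>c a. D (weyl_scale c a) = weyl_scale c (D a)"
    and one: "D 1 = 0"
    and gen: "\<And>g a. D (a * weyl_z g) = D a * weyl_z g + T g a"
    and comm: "\<And>g a. D (T g a) = T g (D a)"
    and T0: "\<And>g. T g 0 = 0"
  shows "\<exists>m. (D ^^ m) a = 0"
proof -
  have D0: "D 0 = 0"
    using add[of 0 0] by simp
  have Dpow: "(D ^^ m) (T g a) = T g ((D ^^ m) a)" for m g a
    by (induction m) (simp_all add: comm)
  \<comment> \<open>A further generator costs at most one more application of \<open>D\<close>: the
    summand with \<open>D b\<close> falls to the induction hypothesis, and powers of
    \<open>D\<close> move past \<open>T g\<close> onto \<open>b\<close>.\<close>
  have step: "(D ^^ Suc m) (b * weyl_z g) = 0" if "(D ^^ m) b = 0" for m b g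
    using that
  proof (induction m arbitrary: b)
    case 0
    then show ?case by (simp add: D0)
  next
    case (Suc m)
    have "(D ^^ Suc (Suc m)) (b * weyl_z g) =
        (D ^^ Suc m) (D b * weyl_z g) + (D ^^ Suc m) (T g b)"
      by (simp only: funpow_Suc_right[of "Suc m"] comp_apply gen funpow_additive[of D, OF add])
    also have "\<dots> = 0"
      using Suc.IH[of "D b"] Suc.prems Dpow[of "Suc m" g b]
      by (simp add: T0 funpow_swap1)
    finally show ?case .
  qed
  have "a \<in> weyl_subalgebra UNIV"
    by (rule weyl_subalgebra_UNIV)
  then show ?thesis
  proof induction
    case one
    show ?case
      by (rule exI[of _ 1]) (simp add: assms(3))
  next
    case (scale a c)
    have "(D ^^ m) (weyl_scale c a) = weyl_scale c ((D ^^ m) a)" for m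
      by (induction m) (simp_all add: assms(2))
    with scale.IH show ?case by auto
  next
    case (add a b)
    then obtain m n where "(D ^^ m) a = 0" "(D ^^ n) b = 0" by blast
    then have "(D ^^ max m n) (a + b) = 0"
      by (simp add: funpow_additive[of D, OF assms(1)] D0
          funpow_eq_zero_mono[of D m a] funpow_eq_zero_mono[of D n b])
    then show ?case ..
  next
    case (mult_gen a g)
    then show ?case using step by blast
  qed
qed

section \<open>Partial derivatives as inner derivations\<close>

text \<open>The two commutators are ordered oppositely so that each takes the value 1 on its own
  generator.\<close>

definition weyl_deriv :: "'n weyl_gen \<Rightarrow> ('n, 'k::field) weyl \<Rightarrow> ('n, 'k) weyl"
  where "weyl_deriv g a = (case g of
      Gen_x i \<Rightarrow> a * weyl_y i - weyl_y i * a
    | Gen_y i \<Rightarrow> weyl_x i * a - a * weyl_x i)"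

lemma weyl_deriv_add: "weyl_deriv g (a + b) = weyl_deriv g a + weyl_deriv g b"
  by (simp add: weyl_deriv_def algebra_simps split: weyl_gen.split)

lemma weyl_deriv_zero: "weyl_deriv g 0 = 0"
  by (simp add: weyl_deriv_def split: weyl_gen.split)

lemma weyl_deriv_one: "weyl_deriv g 1 = 0"
  by (simp add: weyl_deriv_def split: weyl_gen.split)

lemma weyl_deriv_scale: "weyl_deriv g (weyl_scale c a) = weyl_scale c (weyl_deriv g a)"
  by (simp add: weyl_deriv_def weyl_scale_mult_left weyl_scale_mult_right
      weyl.scale_right_diff_distrib split: weyl_gen.split)

lemma weyl_deriv_mult: "weyl_deriv g (a * b) = weyl_deriv g a * b + a * weyl_deriv g b"
  by (simp add: weyl_deriv_def algebra_simps split: weyl_gen.split)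

lemma weyl_deriv_z: "weyl_deriv g (weyl_z h) = (if g = h then 1 else 0)"
proof (cases g; cases h)
  fix i j
  assume "g = Gen_x i" "h = Gen_x j"
  then show ?thesis
    by (cases "i = j") (simp_all add: weyl_deriv_def weyl_z_def weyl_relations(3,4))
next
  fix i j
  assume "g = Gen_y i" "h = Gen_y j"
  then show ?thesis
    by (cases "i = j") (simp_all add: weyl_deriv_def weyl_z_def weyl_relations(3,4))
qed (simp_all add: weyl_deriv_def weyl_z_def weyl_relations(1,2))

lemma weyl_deriv_mult_z:
  "weyl_deriv g (a * weyl_z h) = weyl_deriv g a * weyl_z h + (if g = h then a else 0)"
  by (simp add: weyl_deriv_mult weyl_deriv_z)

lemma weyl_deriv_z_mult: "weyl_deriv g (weyl_z g * a) = weyl_z g * weyl_deriv g a + a"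
  by (simp add: weyl_deriv_mult weyl_deriv_z)

lemma weyl_deriv_commute: "weyl_deriv g (weyl_deriv h a) = weyl_deriv h (weyl_deriv g a)"
  using weyl_subalgebra_UNIV[of a]
  by induction (simp_all add: weyl_deriv_add weyl_deriv_zero weyl_deriv_one weyl_deriv_scale
      weyl_deriv_mult_z)

lemma weyl_deriv_locally_nilpotent: "\<exists>m. (weyl_deriv g ^^ m) a = 0"
  by (rule locally_nilpotent[where T = "\<lambda>h a. if g = h then a else 0"])
    (simp_all add: weyl_deriv_add weyl_deriv_zero weyl_deriv_one weyl_deriv_scale
      weyl_deriv_mult_z)

section \<open>Splitting off a generator\<close>

lemma weyl_deriv_subalgebra:
  "a \<in> weyl_subalgebra T \<Longrightarrow> weyl_deriv g a \<in> weyl_subalgebra T"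
  by (induction rule: weyl_subalgebra.induct)
    (auto simp: weyl_deriv_add weyl_deriv_one weyl_deriv_scale weyl_deriv_mult_z
      weyl_subalgebra_zero intro: weyl_subalgebra.intros)

lemma weyl_deriv_subalgebra_eq_zero:
  "a \<in> weyl_subalgebra T \<Longrightarrow> g \<notin> T \<Longrightarrow> weyl_deriv g a = 0"
  by (induction rule: weyl_subalgebra.induct)
    (auto simp: weyl_deriv_add weyl_deriv_one weyl_deriv_scale weyl_deriv_mult_z)

text \<open>The commutator with a generator is, up to sign, the derivative with respect to the
  conjugate generator, and derivatives preserve the subalgebra.\<close>

lemma weyl_subalgebra_mult_z:
  assumes "a \<in> weyl_subalgebra T"
  shows "\<exists>d\<in>weyl_subalgebra T. a * weyl_z g = weyl_z g * a + d"
proof (cases g)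
  case (Gen_x i)
  show ?thesis
    by (rule bexI[of _ "- weyl_deriv (Gen_y i) a"])
      (simp_all add: Gen_x weyl_z_def weyl_deriv_def[of "Gen_y i"]
        weyl_subalgebra_uminus[OF weyl_deriv_subalgebra[OF assms], of "Gen_y i",
          unfolded weyl_deriv_def, simplified])
next
  case (Gen_y i)
  show ?thesis
    by (rule bexI[of _ "weyl_deriv (Gen_x i) a"])
      (simp_all add: Gen_y weyl_z_def weyl_deriv_def[of "Gen_x i"]
        weyl_deriv_subalgebra[OF assms, of "Gen_x i", unfolded weyl_deriv_def, simplified])
qed

text \<open>Occurrences of \<open>weyl_z g\<close> are moved to the front; the commutators that
  arise stay in \<open>weyl_subalgebra T\<close>.\<close>

lemma weyl_subalgebra_insert:
  assumes "a \<in> weyl_subalgebra (insert g T)"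
  shows "\<exists>v\<in>weyl_subalgebra T. \<exists>b. a = v + weyl_z g * b"
  using assms
proof induction
  case one
  show ?case
    by (rule bexI[OF _ weyl_subalgebra.one], rule exI[of _ 0]) simp
next
  case (scale a c)
  then obtain v b where "v \<in> weyl_subalgebra T" "a = v + weyl_z g * b" by blast
  then show ?case
    by (intro bexI[of _ "weyl_scale c v"] exI[of _ "weyl_scale c b"])
      (simp_all add: weyl.scale_right_distrib weyl_scale_mult_right weyl_subalgebra.scale)
next
  case (add a a')
  then obtain v b v' b' where "v \<in> weyl_subalgebra T" "a = v + weyl_z g * b"
    "v' \<in> weyl_subalgebra T" "a' = v' + weyl_z g * b'" by blast
  then show ?case
    by (intro bexI[of _ "v + v'"] exI[of _ "b + b'"])
      (simp_all add: algebra_simps weyl_subalgebra.add)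
next
  case (mult_gen a h)
  then obtain v b where v: "v \<in> weyl_subalgebra T" and a: "a = v + weyl_z g * b" by blast
  show ?case
  proof (cases "h = g")
    case True
    obtain d where "d \<in> weyl_subalgebra T" "v * weyl_z g = weyl_z g * v + d"
      using weyl_subalgebra_mult_z[OF v] by blast
    then show ?thesis
      by (intro bexI[of _ d] exI[of _ "v + b * weyl_z g"]) (simp_all add: a True algebra_simps)
  next
    case False
    then show ?thesis
      using v mult_gen.hyps
      by (intro bexI[of _ "v * weyl_z h"] exI[of _ "b * weyl_z h"])
        (auto simp: a algebra_simps intro: weyl_subalgebra.mult_gen)
  qed
qed

text \<open>Differentiating \<open>b = - z\<^sub>g D b\<close> repeatedly gives \<open>(m + 1) D\<^sup>m b = - z\<^sub>g D\<^sup>m\<^sup>+\<^sup>1 b\<close>, so that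
  nilpotence propagates downwards.\<close>

lemma weyl_deriv_z_mult_eq_zeroD:
  fixes b :: "('n, 'k::field_char_0) weyl"
  assumes "weyl_deriv g (weyl_z g * b) = 0"
  shows "b = 0"
proof -
  let ?D = "weyl_deriv g :: ('n, 'k) weyl \<Rightarrow> _"
  have eq: "weyl_z g * (?D ^^ Suc m) b + weyl_scale (of_nat (Suc m)) ((?D ^^ m) b) = 0" for m
  proof (induction m)
    case 0
    then show ?case using assms by (simp add: weyl_deriv_z_mult)
  next
    case (Suc m)
    have "weyl_scale 2 a = a + a" for a :: "('n, 'k) weyl"
      using weyl.scale_left_distrib[of 1 1 a] by simp
    with arg_cong[OF Suc, of ?D] show ?case
      by (simp add: weyl_deriv_add weyl_deriv_z_mult weyl_deriv_scale weyl_deriv_zero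
          weyl.scale_left_distrib add_ac)
  qed
  have down: "(?D ^^ m) b = 0" if "(?D ^^ Suc m) b = 0" for m
  proof -
    have "weyl_scale (of_nat (Suc m)) ((?D ^^ m) b) = 0"
      using eq[of m] by (simp only: that) simp
    \<comment> \<open>Characteristic zero makes the scalar \<open>of_nat (Suc m)\<close> nonzero, so
      it can be cancelled.\<close>
    then show ?thesis
      by (metis nat.distinct(1) of_nat_eq_0_iff weyl.scale_eq_0_iff)
  qed
  have "b = 0" if "(?D ^^ m) b = 0" for m
    using that by (induction m) (use down in auto)
  then show ?thesis
    using weyl_deriv_locally_nilpotent by blast
qed

lemma weyl_deriv_eq_zero_imp_subalgebra:
  fixes a :: "('n, 'k::field_char_0) weyl"
  assumes "finite S" "\<And>g. g \<in> S \<Longrightarrow> weyl_deriv g a = 0"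
  shows "a \<in> weyl_subalgebra (- S)"
  using assms
proof (induction S)
  case empty
  then show ?case by (simp add: weyl_subalgebra_UNIV)
next
  case (insert g S)
  \<comment> \<open>Exhibits \<open>g\<close> as the generator to be split off next.\<close>
  have "- S = insert g (- insert g S)"
    using insert.hyps by auto
  then obtain v b where v: "v \<in> weyl_subalgebra (- insert g S)" and a: "a = v + weyl_z g * b"
    using insert.IH insert.prems weyl_subalgebra_insert by (metis insertCI)
  have "weyl_deriv g (weyl_z g * b) = 0"
    using insert.prems[of g] weyl_deriv_subalgebra_eq_zero[OF v, of g]
    by (simp add: a weyl_deriv_add)
  then have "b = 0"
    by (rule weyl_deriv_z_mult_eq_zeroD)
  with v a show ?case by simp
qed

lemma weyl_subalgebra_empty: "a \<in> weyl_subalgebra {} \<Longrightarrow> \<exists>c. a = weyl_scale c 1"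
proof (induction rule: weyl_subalgebra.induct)
  case one
  show ?case by (rule exI[of _ 1]) simp
next
  case (scale a c)
  then show ?case by (metis weyl.scale_scale)
next
  case (add a b)
  then show ?case by (metis weyl.scale_left_distrib)
qed simp

section \<open>Simplicity of the Weyl algebra\<close>

lemma finite_UNIV_weyl_gen: "finite (UNIV :: 'n::finite weyl_gen set)"
proof -
  have "(UNIV :: 'n weyl_gen set) \<subseteq> range Gen_x \<union> range Gen_y"
    by (metis UnCI rangeI subsetI weyl_gen.exhaust)
  then show ?thesis
    by (rule finite_subset) simp
qed

text \<open>For each generator in turn, the last nonzero iterated derivative is taken; since
  derivatives commute, those that vanished before still vanish.\<close>

lemma exists_weyl_deriv_eq_zero:
  assumes "finite S" "q \<in> I" "q \<noteq> 0"
    and closed: "\<And>g a. a \<in> I \<Longrightarrow> weyl_deriv g a \<in> I"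
  shows "\<exists>a\<in>I. a \<noteq> 0 \<and> (\<forall>g\<in>S. weyl_deriv g a = 0)"
  using assms(1)
proof (induction S)
  case empty
  then show ?case using assms(2,3) by auto
next
  case (insert g S)
  then obtain a where a: "a \<in> I" "a \<noteq> 0" and S: "\<And>h. h \<in> S \<Longrightarrow> weyl_deriv h a = 0"
    by blast
  define m where "m = (LEAST m. (weyl_deriv g ^^ m) a = 0)"
  have m0: "(weyl_deriv g ^^ m) a = 0"
    unfolding m_def by (rule LeastI_ex) (rule weyl_deriv_locally_nilpotent)
  \<comment> \<open>As \<open>a\<close> is nonzero, the least annihilating exponent is positive, and
    its predecessor gives the last nonzero iterate.\<close>
  with a(2) obtain l where l: "m = Suc l"
    by (cases m) auto
  let ?b = "(weyl_deriv g ^^ l) a"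
  have "?b \<in> I"
    by (induction l) (simp_all add: a closed)
  moreover have "?b \<noteq> 0"
    using not_less_Least[of l "\<lambda>m. (weyl_deriv g ^^ m) a = 0"] l by (simp add: m_def)
  moreover have "weyl_deriv g ?b = 0"
    using m0 l by simp
  moreover have "weyl_deriv h ?b = 0" if "h \<in> S" for h
  proof -
    have "weyl_deriv h ((weyl_deriv g ^^ j) a) = (weyl_deriv g ^^ j) (weyl_deriv h a)" for j
      by (induction j) (simp_all add: weyl_deriv_commute[of h g])
    then show ?thesis
      by (simp add: S[OF that] funpow_fixpoint weyl_deriv_zero)
  qed
  ultimately show ?case by blast
qed

lemma two_sided_ideal_eq_UNIV:
  fixes I :: "('n::finite, 'k::field_char_0) weyl set"
  assumes I: "two_sided_ideal weyl_scale (*) I" and "q \<in> I" "q \<noteq> 0"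
  shows "I = UNIV"
proof -
  have sub: "weyl.subspace I" and mult: "\<And>a q. q \<in> I \<Longrightarrow> a * q \<in> I" "\<And>a q. q \<in> I \<Longrightarrow> q * a \<in> I"
    using I by (auto simp: two_sided_ideal_def)
  \<comment> \<open>A commutator with an element of an ideal stays in the ideal.\<close>
  have "weyl_deriv g a \<in> I" if "a \<in> I" for g a
    using that by (auto simp: weyl_deriv_def mult weyl.subspace_diff[OF sub] split: weyl_gen.split)
  then obtain a where a: "a \<in> I" "a \<noteq> 0" "\<And>g. weyl_deriv g a = 0"
    using exists_weyl_deriv_eq_zero[OF finite_UNIV_weyl_gen assms(2,3)] by blast
  then obtain c where c: "a = weyl_scale c 1"
    using weyl_deriv_eq_zero_imp_subalgebra[OF finite_UNIV_weyl_gen, of a] weyl_subalgebra_empty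
    by auto
  with a(2) have "c \<noteq> 0" by auto
  then have "weyl_scale (inverse c) a = 1"
    by (simp add: c)
  then have "1 \<in> I"
    using weyl.subspace_scale[OF sub a(1), of "inverse c"] by simp
  then show ?thesis
    using mult(1)[of 1] by auto
qed

section \<open>From the twisted product back to the associative one\<close>

text \<open>Multiplicativity of the shift turns the added constant \<open>k $ i\<close> into the
  correction term \<open>T\<close>, which commutes with the shift.\<close>

lemma weyl_shift_minus_id_locally_nilpotent: "\<exists>m. ((\<lambda>a. weyl_shift k a - a) ^^ m) a = 0"
proof (rule locally_nilpotent[where T = "\<lambda>g a. case g of
      Gen_x i \<Rightarrow> 0 | Gen_y i \<Rightarrow> weyl_scale (k $ i) (weyl_shift k a)"])
  show "weyl_shift k (a * weyl_z g) - a * weyl_z g = (weyl_shift k a - a) * weyl_z g +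
      (case g of Gen_x i \<Rightarrow> 0 | Gen_y i \<Rightarrow> weyl_scale (k $ i) (weyl_shift k a))" for g a
    by (simp add: weyl_z_def weyl_shift_mult weyl_scale_mult_right algebra_simps
        split: weyl_gen.split)
qed (auto simp: weyl_shift_add weyl_shift_diff weyl_shift_scale weyl.scale_right_diff_distrib
    weyl_shift_diff[of k 0 0, simplified] split: weyl_gen.split)

text \<open>With \<open>D a = weyl_shift k a - a\<close>, the hypotheses pass from \<open>a\<close>
  to \<open>D a\<close>, which has smaller nilpotency order; then \<open>a\<close> is recovered as
  \<open>weyl_shift k a - D a\<close>.\<close>

lemma subspace_weyl_shift_cancel:
  assumes sub: "weyl.subspace I" and stable: "\<And>a. a \<in> I \<Longrightarrow> weyl_shift k a \<in> I"
    and "weyl_shift k a \<in> I"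
  shows "a \<in> I"
proof -
  have "a \<in> I" if "((\<lambda>a. weyl_shift k a - a) ^^ m) a = 0" "weyl_shift k a \<in> I" for m
    using that
  proof (induction m arbitrary: a)
    case 0
    then show ?case using weyl.subspace_0[OF sub] by simp
  next
    case (Suc m)
    have "weyl_shift k (weyl_shift k a - a) \<in> I"
      using Suc.prems(2) stable by (simp add: weyl_shift_diff weyl.subspace_diff[OF sub])
    then have "weyl_shift k a - a \<in> I"
      using Suc.IH[of "weyl_shift k a - a"] Suc.prems(1) by (simp only: funpow_Suc_right comp_apply)
    from weyl.subspace_diff[OF sub Suc.prems(2) this] show ?case by simp
  qed
  then show ?thesis
    using weyl_shift_minus_id_locally_nilpotent assms(3) by blast
qed

lemma two_sided_ideal_hom_weyl_mult_imp:
  assumes "two_sided_ideal weyl_scale (hom_weyl_mult k) I"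
  shows "two_sided_ideal weyl_scale (*) I"
proof -
  have sub: "weyl.subspace I"
    and left: "\<And>a q. q \<in> I \<Longrightarrow> weyl_shift k (a * q) \<in> I"
    and right: "\<And>a q. q \<in> I \<Longrightarrow> weyl_shift k (q * a) \<in> I"
    using assms by (auto simp: two_sided_ideal_def hom_weyl_mult_def yau_twist_def)
  \<comment> \<open>Twisted multiplication by \<open>1\<close> is the shift itself.\<close>
  have "weyl_shift k q \<in> I" if "q \<in> I" for q
    using left[OF that, of 1] by simp
  then have "a \<in> I" if "weyl_shift k a \<in> I" for a
    using subspace_weyl_shift_cancel[OF sub] that by blast
  then show ?thesis
    using sub left right by (auto simp: two_sided_ideal_def)
qed

theorem corollary1:
  fixes k :: "'k::field_char_0 ^ 'n::finite"
  assumes "(\<Prod>i\<in>UNIV. k $ i) \<noteq> 0"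
  shows "simple_algebra weyl_scale (hom_weyl_mult k)"
proof -
  have "two_sided_ideal weyl_scale (hom_weyl_mult k) I \<longleftrightarrow> I = {0} \<or> I = UNIV" for I
  proof
    assume I: "two_sided_ideal weyl_scale (hom_weyl_mult k) I"
    then have "0 \<in> I"
      by (simp add: two_sided_ideal_def weyl.subspace_0)
    then show "I = {0} \<or> I = UNIV"
      using two_sided_ideal_eq_UNIV[OF two_sided_ideal_hom_weyl_mult_imp[OF I]] by blast
  next
    assume "I = {0} \<or> I = UNIV"
    then show "two_sided_ideal weyl_scale (hom_weyl_mult k) I"
      \<comment> \<open>This instance yields \<open>weyl_shift k 0 = 0\<close>, which the zero ideal
        requires.\<close>
      using weyl_shift_diff[of k 0 0]
      by (auto simp: two_sided_ideal_def hom_weyl_mult_def yau_twist_def weyl.subspace_def)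
  qed
  then show ?thesis
    by (auto simp: simple_algebra_def)
qed

end
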